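(* Let $\{(G_n,r_n),g_n^{n+1}\}_{n\in\mathbb{N}}$ and $\{(H_n,s_n),h_n^{n+1}\}_{n\in\mathbb{N}}$ be g-cell structures. Let $f\colon\bigcup_{i\in\mathbb{N}}G_i\to\bigcup_{i\in\mathbb{N}}H_i$ be an upper semi-continuous g-cell map. If for each $\overline{x}\in G_\infty$ and for each $i\in\mathbb{N}$ the set $f(x_i)\cap H_i$ is a singleton, then the weak g-cell map $\overline{f}\colon G_\infty\to H_\infty$ induced by $f$ is continuous. Hence $f$ induces a continuous function $\widehat{\overline{f}}\colon G^\ast\to H^\ast$.
   Context: $\mathbb{N}=\{1,2,3,\dots\}$. A cellular graph is a pair $(G,r)$ with $G$ a non-empty topological space and $r\subset G\times G$ a reflexive and symmetric relation. An inverse sequence of cellular graphs $\{(G_n,r_n),g_n^{n+1}\}_{n\in\mathbb{N}}$ consists of cellular graphs $(G_n,r_n)$ and continuous bonding maps $g_n^{n+1}\colon G_{n+1}\to G_n$ with $(g_n^{n+1}(x),g_n^{n+1}(y))\in r_n$ whenever $(x,y)\in r_{n+1}$; $g_n^m\colon G_m\to G_n$ ($n\le m$) denotes the composite of bonding maps, with $g_n^n$ the identity (similarly $h_n^m$). Its inverse limit is $G_\infty=\{\overline{x}=(x_n)_{n}\in\prod_n G_n : g_i^j(x_j)=x_i \text{ for all } j\ge i\}$ with the subspace topology of the product topology. The natural relation on $G_\infty$ is $r=\{(\overline{x},\overline{y}) : (x_n,y_n)\in r_n \ \forall n\in\mathbb{N}\}$. The inverse sequence is a g-cell structure if $r$ is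 an equivalence relation. In that case $G^\ast=G_\infty/r$ with the quotient topology, and $[\overline{x}]\in G^\ast$ is the class of $\overline{x}$. Analogously $H_\infty$, $s$ and $H^\ast=H_\infty/s$ are obtained from $\{(H_n,s_n),h_n^{n+1}\}$. The unions $\bigcup_n G_n$, $\bigcup_n H_n$ are disjoint unions with the sum topology ($O$ is open iff $O\cap G_n$ is open in $G_n$ for all $n$, and similarly for $H$). A g-cell map is a set-valued function $f\colon\bigcup_i G_i\to\bigcup_i H_i$ (each $f(x)$ is a subset of $\bigcup_i H_i$) such that: (1) $h_i^j(f(x)\cap H_j)\subset f(x)\cap H_i$ for $i\le j$; (2) if $i\le j$, $k\in\mathbb{N}$ and $x\in G_j$ with $f(g_i^j(x))\cap H_k\ne\emptyset$, then $f(x)\cap H_k\neq\emptyset$ and $f(x)\cap H_k\subset f(g_i^j(x))$; (3) if $a\in f(x)\cap H_k$ and $b\in f(y)\cap H_k$, where $x,y\in G_i$ are such that $(x,y)\in r_i$, then $(a,b)\in s_k$; (4) for each $\overline{x}\in G_\infty$ and $k\in\mathbb{N}$ there exists $i\in\mathbb{N}$ such that $f(x_i)\cap H_k$ is a Hausdorff, compact, nonempty set. Such $f$ is upper semi-continuous if, for every $i\in\mathbb{N}$ and every open $W_i\subset H_i$, the set $\{x\in\bigcup_{n} G_n : f(x)\subset W_i\}$ is open. A weak g-cell map is a function $\varphi\colon G_\infty\to H_\infty$ such that $(\overline{x},\overline{y})\in r$ implies $(\varphi(\overline{x}),\varphi(\overline{y}))\in s$; it induces the function $\widehat{\varphi}\colon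 G^\ast\to H^\ast$ given by $\widehat{\varphi}([\overline{x}])=[\varphi(\overline{x})]$. The weak g-cell map $\overline{f}$ induced by a g-cell map $f$ is defined as follows: for $\overline{x}\in G_\infty$ choose indices $\alpha_1<\alpha_2<\cdots$ such that each $K_i=f(x_{\alpha_i})\cap H_i$ is Hausdorff, compact and nonempty; then $h_i^{i+1}(K_{i+1})\subset K_i$, and $\overline{f}(\overline{x})$ is a chosen element of $\varprojlim(K_i,h_i^{i+1}|_{K_{i+1}})\subset H_\infty$.
   Formalization: Upper semi-continuity is taken as: {x : f(x)∩H_i ⊂ W_i} is open for every i and open W_i ⊂ H_i; with the printed {x : f(x) ⊂ W_i} the claim is false, since that set is empty whenever each f(x) meets two of the H_k. *)

theory Defs
  imports "HOL-Analysis.Analysis"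
begin

text \<open>
  Sequences are indexed by \<^typ>\<open>nat\<close> starting at 0 instead of 1; only the order of the indices
  is ever used.  The spaces of a sequence are topologies on subsets of one common type.
\<close>

definition cellular_graph :: "'a topology \<Rightarrow> 'a rel \<Rightarrow> bool" where
  "cellular_graph X r \<longleftrightarrow>
     topspace X \<noteq> {} \<and> r \<subseteq> topspace X \<times> topspace X \<and> refl_on (topspace X) r \<and> sym r"

definition cellular_inverse_sequence ::
    "(nat \<Rightarrow> 'a topology) \<Rightarrow> (nat \<Rightarrow> 'a rel) \<Rightarrow> (nat \<Rightarrow> 'a \<Rightarrow> 'a) \<Rightarrow> bool" where
  "cellular_inverse_sequence G r g \<longleftrightarrow>
     (\<forall>n. cellular_graph (G n) (r n)) \<and>
     (\<forall>n. continuous_map (G (Suc n)) (G n) (g n)) \<and>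
     (\<forall>n x y. (x, y) \<in> r (Suc n) \<longrightarrow> (g n x, g n y) \<in> r n)"

text \<open>
  For \<open>n \<le> m\<close>, \<open>bond g n m\<close> is the composite \<open>g n \<circ> g (n + 1) \<circ> \<dots> \<circ> g (m - 1)\<close> from the
  \<open>m\<close>-th to the \<open>n\<close>-th space; for \<open>m \<le> n\<close> it is the identity.
\<close>
primrec bond :: "(nat \<Rightarrow> 'a \<Rightarrow> 'a) \<Rightarrow> nat \<Rightarrow> nat \<Rightarrow> 'a \<Rightarrow> 'a" where
  "bond g n 0 = id"
| "bond g n (Suc m) = (if n \<le> m then bond g n m \<circ> g m else id)"

definition inverse_limit ::
    "(nat \<Rightarrow> 'a topology) \<Rightarrow> (nat \<Rightarrow> 'a \<Rightarrow> 'a) \<Rightarrow> (nat \<Rightarrow> 'a) topology" where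
  "inverse_limit G g =
     subtopology (product_topology G UNIV) {x. \<forall>i j. i \<le> j \<longrightarrow> bond g i j (x j) = x i}"

definition natural_relation ::
    "(nat \<Rightarrow> 'a topology) \<Rightarrow> (nat \<Rightarrow> 'a rel) \<Rightarrow> (nat \<Rightarrow> 'a \<Rightarrow> 'a) \<Rightarrow> (nat \<Rightarrow> 'a) rel" where
  "natural_relation G r g =
     {(x, y). x \<in> topspace (inverse_limit G g) \<and> y \<in> topspace (inverse_limit G g) \<and>
              (\<forall>n. (x n, y n) \<in> r n)}"

definition g_cell_structure ::
    "(nat \<Rightarrow> 'a topology) \<Rightarrow> (nat \<Rightarrow> 'a rel) \<Rightarrow> (nat \<Rightarrow> 'a \<Rightarrow> 'a) \<Rightarrow> bool" where
  "g_cell_structure G r g \<longleftrightarrow>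
     cellular_inverse_sequence G r g \<and>
     equiv (topspace (inverse_limit G g)) (natural_relation G r g)"

definition quotient_topology :: "'a topology \<Rightarrow> 'a rel \<Rightarrow> 'a set topology" where
  "quotient_topology X R =
     topology (\<lambda>U. U \<subseteq> topspace X // R \<and> openin X {x \<in> topspace X. R `` {x} \<in> U})"

lemma istopology_quotient:
  "istopology (\<lambda>U. U \<subseteq> topspace X // R \<and> openin X {x \<in> topspace X. R `` {x} \<in> U})"
proof -
  have 1: "{x \<in> topspace X. R `` {x} \<in> S \<inter> T} =
      {x \<in> topspace X. R `` {x} \<in> S} \<inter> {x \<in> topspace X. R `` {x} \<in> T}" for S T
    by auto
  have 2: "{x \<in> topspace X. R `` {x} \<in> \<Union>\<K>} =
      (\<Union>K\<in>\<K>. {x \<in> topspace X. R `` {x} \<in> K})" for \<K>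
    by auto
  show ?thesis
    unfolding istopology_def 1 2 by blast
qed

lemma openin_quotient_topology:
  "openin (quotient_topology X R) U \<longleftrightarrow>
     U \<subseteq> topspace X // R \<and> openin X {x \<in> topspace X. R `` {x} \<in> U}"
  by (simp add: quotient_topology_def istopology_quotient)

lemma topspace_quotient_topology [simp]: "topspace (quotient_topology X R) = topspace X // R"
proof -
  have "{x \<in> topspace X. R `` {x} \<in> topspace X // R} = topspace X"
    by (auto intro: quotientI)
  then have "openin (quotient_topology X R) (topspace X // R)"
    by (simp add: openin_quotient_topology)
  then show ?thesis
    by (meson openin_quotient_topology openin_subset openin_topspace subset_antisym)
qed

definition cell_quotient ::
    "(nat \<Rightarrow> 'a topology) \<Rightarrow> (nat \<Rightarrow> 'a rel) \<Rightarrow> (nat \<Rightarrow> 'a \<Rightarrow> 'a) \<Rightarrow> (nat \<Rightarrow> 'a) set topology" where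
  "cell_quotient G r g = quotient_topology (inverse_limit G g) (natural_relation G r g)"

text \<open>
  A point \<open>x\<close> of the \<open>n\<close>-th summand of a disjoint union is the pair \<open>(n, x)\<close>.  For a subset \<open>A\<close> of
  the disjoint union, the relational image \<open>A `` {k} = {b. (k, b) \<in> A}\<close> is therefore the
  intersection of \<open>A\<close> with the \<open>k\<close>-th summand.
\<close>

definition compact_Hausdorff_nonempty_in :: "'a topology \<Rightarrow> 'a set \<Rightarrow> bool" where
  "compact_Hausdorff_nonempty_in X K \<longleftrightarrow>
     Hausdorff_space (subtopology X K) \<and> compactin X K \<and> K \<noteq> {}"

definition g_cell_map ::
    "(nat \<Rightarrow> 'a topology) \<Rightarrow> (nat \<Rightarrow> 'a rel) \<Rightarrow> (nat \<Rightarrow> 'a \<Rightarrow> 'a) \<Rightarrow>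
     (nat \<Rightarrow> 'b topology) \<Rightarrow> (nat \<Rightarrow> 'b rel) \<Rightarrow> (nat \<Rightarrow> 'b \<Rightarrow> 'b) \<Rightarrow>
     (nat \<times> 'a \<Rightarrow> (nat \<times> 'b) set) \<Rightarrow> bool" where
  "g_cell_map G r g H s h f \<longleftrightarrow>
     (\<forall>p \<in> topspace (sum_topology G UNIV). f p \<subseteq> topspace (sum_topology H UNIV)) \<and>
     (\<forall>p \<in> topspace (sum_topology G UNIV). \<forall>i j. i \<le> j \<longrightarrow>
        bond h i j ` (f p `` {j}) \<subseteq> f p `` {i}) \<and>
     (\<forall>i j k. \<forall>x \<in> topspace (G j). i \<le> j \<and> f (i, bond g i j x) `` {k} \<noteq> {} \<longrightarrow>
        f (j, x) `` {k} \<noteq> {} \<and> f (j, x) `` {k} \<subseteq> f (i, bond g i j x) `` {k}) \<and>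
     (\<forall>i k x y a b. (x, y) \<in> r i \<and> a \<in> f (i, x) `` {k} \<and> b \<in> f (i, y) `` {k} \<longrightarrow>
        (a, b) \<in> s k) \<and>
     (\<forall>x \<in> topspace (inverse_limit G g). \<forall>k. \<exists>i.
        compact_Hausdorff_nonempty_in (H k) (f (i, x i) `` {k}))"

text \<open>
  Upper semi-continuity is imposed on the part of \<open>f p\<close> lying in the \<open>i\<close>-th summand.  For g-cell maps
  this implies that \<open>{p. f p \<subseteq> {i} \<times> W}\<close> is open for all \<open>W\<close> open in the \<open>i\<close>-th space, and it follows
  from openness of \<open>{p. f p \<subseteq> O}\<close> for all \<open>O\<close> open in the disjoint union.  The former property alone
  says nothing as soon as \<open>f p\<close> meets several summands.
\<close>
definition upper_semicontinuous ::
    "(nat \<Rightarrow> 'a topology) \<Rightarrow> (nat \<Rightarrow> 'b topology) \<Rightarrow> (nat \<times> 'a \<Rightarrow> (nat \<times> 'b) set) \<Rightarrow> bool" where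
  "upper_semicontinuous G H f \<longleftrightarrow>
     (\<forall>i W. openin (H i) W \<longrightarrow>
        openin (sum_topology G UNIV)
          {p \<in> topspace (sum_topology G UNIV). f p `` {i} \<subseteq> W})"

definition weak_g_cell_map ::
    "(nat \<Rightarrow> 'a topology) \<Rightarrow> (nat \<Rightarrow> 'a rel) \<Rightarrow> (nat \<Rightarrow> 'a \<Rightarrow> 'a) \<Rightarrow>
     (nat \<Rightarrow> 'b topology) \<Rightarrow> (nat \<Rightarrow> 'b rel) \<Rightarrow> (nat \<Rightarrow> 'b \<Rightarrow> 'b) \<Rightarrow>
     ((nat \<Rightarrow> 'a) \<Rightarrow> (nat \<Rightarrow> 'b)) \<Rightarrow> bool" where
  "weak_g_cell_map G r g H s h \<phi> \<longleftrightarrow>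
     \<phi> \<in> topspace (inverse_limit G g) \<rightarrow> topspace (inverse_limit H h) \<and>
     (\<forall>(x, y) \<in> natural_relation G r g. (\<phi> x, \<phi> y) \<in> natural_relation H s h)"

text \<open>
  The function on classes sending the class of \<open>x\<close> to the class of \<open>\<phi> x\<close>: all classes in the union
  coincide if \<open>\<phi>\<close> is a weak g-cell map.
\<close>
definition induced_on_quotient ::
    "(nat \<Rightarrow> 'b topology) \<Rightarrow> (nat \<Rightarrow> 'b rel) \<Rightarrow> (nat \<Rightarrow> 'b \<Rightarrow> 'b) \<Rightarrow>
     ((nat \<Rightarrow> 'a) \<Rightarrow> (nat \<Rightarrow> 'b)) \<Rightarrow> (nat \<Rightarrow> 'a) set \<Rightarrow> (nat \<Rightarrow> 'b) set" where
  "induced_on_quotient H s h \<phi> C = (\<Union>x\<in>C. natural_relation H s h `` {\<phi> x})"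

text \<open>
  The map induced by \<open>f\<close> depends on choices of indices \<open>\<alpha>\<close> and of points; the predicate holds of
  every map on the inverse limit that arises from some such choices.
\<close>
definition induced_by ::
    "(nat \<Rightarrow> 'a topology) \<Rightarrow> (nat \<Rightarrow> 'a \<Rightarrow> 'a) \<Rightarrow> (nat \<Rightarrow> 'b topology) \<Rightarrow> (nat \<Rightarrow> 'b \<Rightarrow> 'b) \<Rightarrow>
     (nat \<times> 'a \<Rightarrow> (nat \<times> 'b) set) \<Rightarrow> ((nat \<Rightarrow> 'a) \<Rightarrow> (nat \<Rightarrow> 'b)) \<Rightarrow> bool" where
  "induced_by G g H h f \<phi> \<longleftrightarrow>
     (\<forall>x \<in> topspace (inverse_limit G g). \<exists>\<alpha>. strict_mono \<alpha> \<and>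
        (let K = (\<lambda>i. f (\<alpha> i, x (\<alpha> i)) `` {i}) in
           (\<forall>i. compact_Hausdorff_nonempty_in (H i) (K i)) \<and>
           \<phi> x \<in> topspace (inverse_limit (\<lambda>i. subtopology (H i) (K i)) h)))"

end

theory Submission
  imports Defs
begin

text \<open>
  A thread \<open>x\<close> of the first sequence has, for every \<open>i\<close>, a single point \<open>c i\<close> in the diagonal value
  \<open>f(x\<^sub>i) \<inter> H\<^sub>i\<close>.  The monotonicity condition on g-cell maps makes \<open>f(x\<^sub>j) \<inter> H\<^sub>i\<close> a non-empty subset
  of \<open>f(x\<^sub>i) \<inter> H\<^sub>i = {c i}\<close> for all \<open>j \<ge> i\<close>, so that it equals \<open>{c i}\<close> too.  Hence the indices
  \<open>\<alpha>\<^sub>i \<ge> i\<close> and the points chosen in the construction of the induced map do not matter: this map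
  sends \<open>x\<close> to \<open>c\<close>, and to nothing else (\<open>induced_by_iff_diagonal\<close>).

  Continuity can then be checked one coordinate at a time, since the inverse limit carries a subspace
  topology of a product.  The \<open>i\<close>-th coordinate lies in an open set \<open>W\<close> iff \<open>f(x\<^sub>i) \<inter> H\<^sub>i \<subseteq> W\<close>, which
  by upper semi-continuity is an open condition on \<open>x\<^sub>i\<close> alone (\<open>continuous_map_diagonal\<close>).  The
  statement about \<open>G\<^sup>*\<close> and \<open>H\<^sup>*\<close> is the universal property of quotient spaces
  (\<open>continuous_map_on_classes\<close>).
\<close>

lemma topspace_inverse_limit:
  "topspace (inverse_limit G g) =
     {x. (\<forall>i. x i \<in> topspace (G i)) \<and> (\<forall>i j. i \<le> j \<longrightarrow> bond g i j (x j) = x i)}"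
  by (auto simp: inverse_limit_def PiE_iff)

lemma class_image_of_compatible_map:
  assumes R: "equiv A R" and S: "equiv B S"
    and comp: "\<And>x y. (x, y) \<in> R \<Longrightarrow> (\<phi> x, \<phi> y) \<in> S"
    and x: "x \<in> A"
  shows "(\<Union>y\<in>R `` {x}. S `` {\<phi> y}) = S `` {\<phi> x}"
proof -
  have "S `` {\<phi> y} = S `` {\<phi> x}" if "y \<in> R `` {x}" for y
    using comp[of x y] that equiv_class_eq[OF S] by auto
  moreover have "x \<in> R `` {x}"
    using R x by (rule equiv_class_self)
  ultimately show ?thesis
    by blast
qed

lemma continuous_map_on_classes:
  assumes R: "equiv (topspace X) R" and S: "equiv (topspace Y) S"
    and comp: "\<And>x y. (x, y) \<in> R \<Longrightarrow> (\<phi> x, \<phi> y) \<in> S"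
    and cont: "continuous_map X Y \<phi>"
  shows "continuous_map (quotient_topology X R) (quotient_topology Y S)
           (\<lambda>C. \<Union>y\<in>C. S `` {\<phi> y})" (is "continuous_map _ _ ?F")
proof -
  have F: "?F (R `` {x}) = S `` {\<phi> x}" if "x \<in> topspace X" for x
    using R S comp that by (rule class_image_of_compatible_map)
  have \<phi>: "\<phi> x \<in> topspace Y" if "x \<in> topspace X" for x
    using cont that by (auto simp: continuous_map_def)
  show ?thesis
    unfolding continuous_map
  proof (intro conjI allI impI)
    show "?F ` topspace (quotient_topology X R) \<subseteq> topspace (quotient_topology Y S)"
    proof (clarsimp elim!: quotientE)
      fix x assume "x \<in> topspace X"
      then show "?F (R `` {x}) \<in> topspace Y // S"
        using \<phi> by (simp only: F quotientI)
    qed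
  next
    fix U assume "openin (quotient_topology Y S) U"
    then have "openin Y {y \<in> topspace Y. S `` {y} \<in> U}"
      by (simp add: openin_quotient_topology)
    then have "openin X {x \<in> topspace X. \<phi> x \<in> {y \<in> topspace Y. S `` {y} \<in> U}}"
      using cont openin_continuous_map_preimage by blast
    also have "{x \<in> topspace X. \<phi> x \<in> {y \<in> topspace Y. S `` {y} \<in> U}} =
        {x \<in> topspace X. R `` {x} \<in> {C \<in> topspace X // R. ?F C \<in> U}}"
      using F \<phi> by (auto intro: quotientI)
    finally show "openin (quotient_topology X R)
        {C \<in> topspace (quotient_topology X R). ?F C \<in> U}"
      by (auto simp: openin_quotient_topology)
  qed
qed

definition diagonal :: "(nat \<times> 'a \<Rightarrow> (nat \<times> 'b) set) \<Rightarrow> (nat \<Rightarrow> 'a) \<Rightarrow> nat \<Rightarrow> 'b" where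
  "diagonal f x i = the_elem (f (i, x i) `` {i})"

lemma diagonal_value:
  assumes "\<forall>x \<in> topspace (inverse_limit G g). \<forall>i. is_singleton (f (i, x i) `` {i})"
    and "x \<in> topspace (inverse_limit G g)"
  shows "f (i, x i) `` {i} = {diagonal f x i}"
  using assms by (simp add: diagonal_def is_singleton_the_elem)

text \<open>
  The values of \<open>f\<close> along a thread decrease in each summand but stay non-empty, so a value that has
  shrunk to a singleton is stationary from then on.
\<close>
lemma later_value_eq_diagonal:
  assumes f: "g_cell_map G r g H s h f"
    and sing: "\<forall>x \<in> topspace (inverse_limit G g). \<forall>i. is_singleton (f (i, x i) `` {i})"
    and x: "x \<in> topspace (inverse_limit G g)"
    and "i \<le> j"
  shows "f (j, x j) `` {i} = {diagonal f x i}"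
proof -
  have val: "f (i, x i) `` {i} = {diagonal f x i}"
    using sing x by (rule diagonal_value)
  have xj: "x j \<in> topspace (G j)" and b: "bond g i j (x j) = x i"
    using x \<open>i \<le> j\<close> by (auto simp: topspace_inverse_limit)
  have "\<forall>i j k. \<forall>x \<in> topspace (G j). i \<le> j \<and> f (i, bond g i j x) `` {k} \<noteq> {} \<longrightarrow>
        f (j, x) `` {k} \<noteq> {} \<and> f (j, x) `` {k} \<subseteq> f (i, bond g i j x) `` {k}"
    using f unfolding g_cell_map_def by (elim conjE)
  from this[rule_format, OF xj, of i i] have
    "f (j, x j) `` {i} \<noteq> {}" "f (j, x j) `` {i} \<subseteq> f (i, x i) `` {i}"
    using \<open>i \<le> j\<close> val unfolding b by blast+
  then show ?thesis
    unfolding val by blast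
qed

text \<open>
  The bonding map carries the point of \<open>f(x\<^sub>j) \<inter> H\<^sub>j\<close> into \<open>f(x\<^sub>j) \<inter> H\<^sub>i\<close>, which is the same singleton
  as \<open>f(x\<^sub>i) \<inter> H\<^sub>i\<close>; hence the diagonal points form a thread.
\<close>
lemma diagonal_in_inverse_limit:
  assumes f: "g_cell_map G r g H s h f"
    and sing: "\<forall>x \<in> topspace (inverse_limit G g). \<forall>i. is_singleton (f (i, x i) `` {i})"
    and x: "x \<in> topspace (inverse_limit G g)"
  shows "diagonal f x \<in> topspace (inverse_limit H h)"
proof -
  have p: "(i, x i) \<in> topspace (sum_topology G UNIV)" for i
    using x by (auto simp: topspace_inverse_limit)
  have "diagonal f x i \<in> topspace (H i)" for i
  proof -
    have "\<forall>p \<in> topspace (sum_topology G UNIV). f p \<subseteq> topspace (sum_topology H UNIV)"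
      using f unfolding g_cell_map_def by (elim conjE)
    moreover have "(i, diagonal f x i) \<in> f (i, x i)"
      using diagonal_value[OF sing x, of i] by auto
    ultimately show ?thesis
      using p[of i] by fastforce
  qed
  moreover have "bond h i j (diagonal f x j) = diagonal f x i" if "i \<le> j" for i j
  proof -
    have "\<forall>p \<in> topspace (sum_topology G UNIV). \<forall>i j. i \<le> j \<longrightarrow>
        bond h i j ` (f p `` {j}) \<subseteq> f p `` {i}"
      using f unfolding g_cell_map_def by (elim conjE)
    from this[rule_format, OF p that, of j]
    show ?thesis
      by (simp add: later_value_eq_diagonal[OF f sing x that] diagonal_value[OF sing x])
  qed
  ultimately show ?thesis
    by (simp add: topspace_inverse_limit)
qed

text \<open>
  Uniqueness uses that a strictly increasing \<open>\<alpha>\<close> satisfies \<open>i \<le> \<alpha> i\<close>, so each \<open>K\<^sub>i\<close> is the diagonal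
  singleton; for existence the identity is an admissible choice of \<open>\<alpha>\<close>, singletons being compact
  Hausdorff.
\<close>
lemma induced_by_iff_diagonal:
  assumes f: "g_cell_map G r g H s h f"
    and sing: "\<forall>x \<in> topspace (inverse_limit G g). \<forall>i. is_singleton (f (i, x i) `` {i})"
  shows "induced_by G g H h f \<phi> \<longleftrightarrow> (\<forall>x \<in> topspace (inverse_limit G g). \<phi> x = diagonal f x)"
proof (intro iffI ballI)
  fix x assume ind: "induced_by G g H h f \<phi>" and x: "x \<in> topspace (inverse_limit G g)"
  then obtain \<alpha> where \<alpha>: "strict_mono \<alpha>"
    and lim: "\<phi> x \<in> topspace (inverse_limit (\<lambda>i. subtopology (H i) (f (\<alpha> i, x (\<alpha> i)) `` {i})) h)"
    unfolding induced_by_def Let_def by blast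
  show "\<phi> x = diagonal f x"
  proof
    fix i
    have "\<phi> x i \<in> f (\<alpha> i, x (\<alpha> i)) `` {i}"
      using lim by (simp add: topspace_inverse_limit)
    then show "\<phi> x i = diagonal f x i"
      using later_value_eq_diagonal[OF f sing x strict_mono_imp_increasing[OF \<alpha>]] by simp
  qed
next
  assume eq: "\<forall>x \<in> topspace (inverse_limit G g). \<phi> x = diagonal f x"
  show "induced_by G g H h f \<phi>"
    unfolding induced_by_def Let_def
  proof (intro ballI exI conjI allI)
    fix x assume x: "x \<in> topspace (inverse_limit G g)"
    note lim = diagonal_in_inverse_limit[OF f sing x]
    show "strict_mono (id :: nat \<Rightarrow> nat)"
      by (simp add: strict_mono_def)
    show "compact_Hausdorff_nonempty_in (H i) (f (id i, x (id i)) `` {i})" for i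
    proof -
      have "Hausdorff_space (subtopology (H i) {diagonal f x i})"
        by (auto simp: Hausdorff_space_def)
      then show ?thesis
        using lim by (simp add: compact_Hausdorff_nonempty_in_def diagonal_value[OF sing x]
            topspace_inverse_limit)
    qed
    show "\<phi> x \<in> topspace (inverse_limit
        (\<lambda>i. subtopology (H i) (f (id i, x (id i)) `` {i})) h)"
      using lim eq x by (simp add: diagonal_value[OF sing x] topspace_inverse_limit)
  qed
qed

lemma diagonal_respects_relations:
  assumes f: "g_cell_map G r g H s h f"
    and sing: "\<forall>x \<in> topspace (inverse_limit G g). \<forall>i. is_singleton (f (i, x i) `` {i})"
    and xy: "(x, y) \<in> natural_relation G r g"
  shows "(diagonal f x, diagonal f y) \<in> natural_relation H s h"
proof -
  have x: "x \<in> topspace (inverse_limit G g)" and y: "y \<in> topspace (inverse_limit G g)"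
    and r: "(x i, y i) \<in> r i" for i
    using xy by (auto simp: natural_relation_def)
  have rule: "\<forall>i k x y a b. (x, y) \<in> r i \<and> a \<in> f (i, x) `` {k} \<and> b \<in> f (i, y) `` {k} \<longrightarrow>
      (a, b) \<in> s k"
    using f unfolding g_cell_map_def by (elim conjE)
  have "(diagonal f x i, diagonal f y i) \<in> s i" for i
    by (rule rule[rule_format, of "x i" "y i" i])
       (simp only: diagonal_value[OF sing x] diagonal_value[OF sing y] r simp_thms singleton_iff)
  then show ?thesis
    by (simp add: natural_relation_def diagonal_in_inverse_limit[OF f sing] x y)
qed

text \<open>
  A singleton meets \<open>W\<close> as soon as it is contained in \<open>W\<close> and conversely, so along threads upper
  semi-continuity of \<open>f\<close> is continuity of each coordinate of the diagonal map.  The values of \<open>f\<close> at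
  points of \<open>G\<^sub>i\<close> that lie on no thread need not be singletons, but the projection from the inverse
  limit never reaches them.
\<close>
lemma continuous_map_diagonal:
  assumes f: "g_cell_map G r g H s h f" and usc: "upper_semicontinuous G H f"
    and sing: "\<forall>x \<in> topspace (inverse_limit G g). \<forall>i. is_singleton (f (i, x i) `` {i})"
  shows "continuous_map (inverse_limit G g) (inverse_limit H h) (diagonal f)"
proof -
  let ?X = "inverse_limit G g"
  have lim: "diagonal f x \<in> topspace (inverse_limit H h)" if "x \<in> topspace ?X" for x
    using f sing that by (rule diagonal_in_inverse_limit)
  have "continuous_map ?X (H i) (\<lambda>x. diagonal f x i)" for i
    unfolding continuous_map
  proof (intro conjI allI impI)
    show "(\<lambda>x. diagonal f x i) ` topspace ?X \<subseteq> topspace (H i)"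
      using lim by (auto simp: topspace_inverse_limit)
  next
    fix W assume "openin (H i) W"
    then have "openin (sum_topology G UNIV)
        {p \<in> topspace (sum_topology G UNIV). f p `` {i} \<subseteq> W}"
      using usc by (simp add: upper_semicontinuous_def)
    then have "openin (G i) {a. (i, a) \<in> {p \<in> topspace (sum_topology G UNIV). f p `` {i} \<subseteq> W}}"
      unfolding openin_sum_topology by blast
    then have "openin (G i) {a \<in> topspace (G i). f (i, a) `` {i} \<subseteq> W}"
      by simp
    moreover have "continuous_map ?X (G i) (\<lambda>x. x i)"
      unfolding inverse_limit_def
      by (intro continuous_map_from_subtopology continuous_map_product_projection) simp
    ultimately have
      "openin ?X {x \<in> topspace ?X. x i \<in> {a \<in> topspace (G i). f (i, a) `` {i} \<subseteq> W}}"
      using openin_continuous_map_preimage by blast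
    also have "{x \<in> topspace ?X. x i \<in> {a \<in> topspace (G i). f (i, a) `` {i} \<subseteq> W}} =
        {x \<in> topspace ?X. diagonal f x i \<in> W}"
    proof (rule Collect_cong, rule conj_cong[OF refl])
      fix x assume x: "x \<in> topspace ?X"
      then have "x i \<in> topspace (G i)"
        by (simp add: topspace_inverse_limit)
      then show "x i \<in> {a \<in> topspace (G i). f (i, a) `` {i} \<subseteq> W} \<longleftrightarrow> diagonal f x i \<in> W"
        by (simp add: diagonal_value[OF sing x])
    qed
    finally show "openin ?X {x \<in> topspace ?X. diagonal f x i \<in> W}" .
  qed
  then have "continuous_map ?X (product_topology H UNIV) (diagonal f)"
    by (simp add: continuous_map_componentwise_UNIV)
  then show ?thesis
    using lim unfolding inverse_limit_def[of H h]
    by (auto simp: continuous_map_in_subtopology)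
qed

theorem theorem3p7:
  fixes G :: "nat \<Rightarrow> 'a topology" and r :: "nat \<Rightarrow> 'a rel" and g :: "nat \<Rightarrow> 'a \<Rightarrow> 'a"
    and H :: "nat \<Rightarrow> 'b topology" and s :: "nat \<Rightarrow> 'b rel" and h :: "nat \<Rightarrow> 'b \<Rightarrow> 'b"
    and f :: "nat \<times> 'a \<Rightarrow> (nat \<times> 'b) set"
  assumes "g_cell_structure G r g"
    and "g_cell_structure H s h"
    and "g_cell_map G r g H s h f"
    and "upper_semicontinuous G H f"
    and "\<forall>x \<in> topspace (inverse_limit G g). \<forall>i. is_singleton (f (i, x i) `` {i})"
  shows "(\<exists>\<phi>. induced_by G g H h f \<phi>) \<and>
    (\<forall>\<phi>. induced_by G g H h f \<phi> \<longrightarrow>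
       weak_g_cell_map G r g H s h \<phi> \<and>
       continuous_map (inverse_limit G g) (inverse_limit H h) \<phi> \<and>
       (\<forall>x \<in> topspace (inverse_limit G g).
          induced_on_quotient H s h \<phi> (natural_relation G r g `` {x}) =
            natural_relation H s h `` {\<phi> x}) \<and>
       continuous_map (cell_quotient G r g) (cell_quotient H s h)
         (induced_on_quotient H s h \<phi>))"
proof -
  let ?X = "inverse_limit G g" and ?Y = "inverse_limit H h"
  let ?R = "natural_relation G r g" and ?S = "natural_relation H s h"
  note f = assms(3) and usc = assms(4) and sing = assms(5)
  have R: "equiv (topspace ?X) ?R" and S: "equiv (topspace ?Y) ?S"
    using assms(1,2) by (simp_all add: g_cell_structure_def)
  have "weak_g_cell_map G r g H s h \<phi> \<and> continuous_map ?X ?Y \<phi> \<and>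
       (\<forall>x \<in> topspace ?X. induced_on_quotient H s h \<phi> (?R `` {x}) = ?S `` {\<phi> x}) \<and>
       continuous_map (cell_quotient G r g) (cell_quotient H s h) (induced_on_quotient H s h \<phi>)"
    if "induced_by G g H h f \<phi>" for \<phi>
  proof (intro conjI ballI)
    have eq: "\<phi> x = diagonal f x" if "x \<in> topspace ?X" for x
      using \<open>induced_by G g H h f \<phi>\<close> that by (simp add: induced_by_iff_diagonal[OF f sing])
    have comp: "(\<phi> x, \<phi> y) \<in> ?S" if "(x, y) \<in> ?R" for x y
    proof -
      have "x \<in> topspace ?X" "y \<in> topspace ?X"
        using that by (simp_all add: natural_relation_def)
      then show ?thesis
        using diagonal_respects_relations[OF f sing that] by (simp add: eq)
    qed
    have ind: "induced_on_quotient H s h \<phi> = (\<lambda>C. \<Union>x\<in>C. ?S `` {\<phi> x})"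
      by (simp add: induced_on_quotient_def fun_eq_iff)
    show "weak_g_cell_map G r g H s h \<phi>"
      using diagonal_in_inverse_limit[OF f sing] comp by (auto simp: weak_g_cell_map_def eq)
    show cont: "continuous_map ?X ?Y \<phi>"
      using continuous_map_diagonal[OF f usc sing] by (rule continuous_map_eq) (simp add: eq)
    show "induced_on_quotient H s h \<phi> (?R `` {x}) = ?S `` {\<phi> x}" if "x \<in> topspace ?X" for x
      unfolding ind using R S comp that by (rule class_image_of_compatible_map)
    show "continuous_map (cell_quotient G r g) (cell_quotient H s h)
        (induced_on_quotient H s h \<phi>)"
      unfolding cell_quotient_def ind using R S comp cont by (rule continuous_map_on_classes)
  qed
  moreover have "induced_by G g H h f (diagonal f)"
    by (simp add: induced_by_iff_diagonal[OF f sing])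
  ultimately show ?thesis
    by blast
qed

end
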